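(* Let $p\geq 2$ be an integer and let $\sigma$ be the substitution on $\{-1,1\}$ given by $\sigma(1)=v_0v_1\cdots v_{p-1}$, $\sigma(-1)=w_0w_1\cdots w_{p-1}$, where $v_i,w_i\in\{-1,1\}$ and $v_0=1$. Let $\mathbf{d}=d_0d_1d_2\cdots=\lim_{n\to\infty}\sigma^n(1)$ and $f(z)=\sum_{n\geq 0}d_nz^n$. If $\mathbf{d}$ is apwenian, then \[f(z)=\prod_{i=0}^{\infty}P(z^{p^i}),\qquad P(z)=v_0+v_1z+\cdots+v_{p-1}z^{p-1}.\]
   Context: Substitutions are extended to words by concatenation, and the limit is taken in the product topology on infinite words (the fixed point of $\sigma$ starting with $1$). For an integer sequence $\mathbf{a}$, $H_n(\mathbf{a})=\det(a_{i+j})_{0\leq i,j\leq n-1}$. A sequence $\mathbf{d}\in\{-1,1\}^{\infty}$ is apwenian if $H_n(\mathbf{d})/2^{n-1}\equiv 1\pmod 2$ for all $n\geq 1$. *)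

theory Defs
  imports
    "HOL-Analysis.Infinite_Products"
    "HOL-Computational_Algebra.Formal_Power_Series"
    "HOL-Number_Theory.Cong"
    "Jordan_Normal_Form.Determinant"
begin

definition subst_ext :: "('a \<Rightarrow> 'a list) \<Rightarrow> 'a list \<Rightarrow> 'a list"
  where "subst_ext \<sigma> u = concat (map \<sigma> u)"

text \<open>
  Convergence of finite words to an infinite word in the product topology over a discrete
  alphabet: every position is eventually present and eventually carries the limit letter.
\<close>

definition words_tendsto :: "(nat \<Rightarrow> 'a list) \<Rightarrow> (nat \<Rightarrow> 'a) \<Rightarrow> bool"
  where "words_tendsto W d \<longleftrightarrow>
    (\<forall>k. \<forall>\<^sub>F n in sequentially. k < length (W n) \<and> W n ! k = d k)"

definition hankel_det :: "(nat \<Rightarrow> int) \<Rightarrow> nat \<Rightarrow> int"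
  where "hankel_det a n = Determinant.det (mat n n (\<lambda>(i, j). a (i + j)))"

text \<open>
  The determinant of an \<open>n \<times> n\<close> matrix with entries \<open>\<plusminus>1\<close> is always divisible by
  \<open>2 ^ (n - 1)\<close>; the divisibility conjunct only records that the quotient is exact.
\<close>

definition apwenian :: "(nat \<Rightarrow> int) \<Rightarrow> bool"
  where "apwenian d \<longleftrightarrow>
    (\<forall>k. d k \<in> {-1, 1}) \<and>
    (\<forall>n\<ge>1. 2 ^ (n - 1) dvd hankel_det d n \<and> [hankel_det d n div 2 ^ (n - 1) = 1] (mod 2))"

end

theory Submission
  imports Defs "HOL-Library.Z2"
begin

text \<open>
  Write \<open>d\<^sub>n = (-1)\<^bsup>c\<^sub>n\<^esup>\<close> with \<open>c\<^sub>n\<close> in the field of two elements. Differences of rows and columns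
  turn \<open>H\<^sub>n\<^sub>+\<^sub>1(d) / 2\<^sup>n\<close> modulo 2 into the Hankel determinant of order \<open>n\<close> of
  \<open>s\<^sub>k = c\<^sub>k + c\<^sub>k\<^sub>+\<^sub>2\<close>, so the functional \<open>L(x\<^sup>k) = s\<^sub>k\<close> has orthogonal polynomials \<open>a\<^sub>m\<close> of every degree,
  with \<open>L(a\<^sub>m\<^sup>2) = 1\<close>. In characteristic 2, squaring the three-term recurrence
  \<open>x a\<^sub>m = a\<^sub>m\<^sub>+\<^sub>1 + \<alpha>\<^sub>m a\<^sub>m + a\<^sub>m\<^sub>-\<^sub>1\<close> gives \<open>L(x (x + 1) q\<^sup>2) = L(q)\<close> first for \<open>q = a\<^sub>m\<close> and then, both
  sides being additive, for all \<open>q\<close>. With \<open>q = x\<^sup>n\<close> this becomes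
  \<open>c\<^sub>2\<^sub>n\<^sub>+\<^sub>1 + c\<^sub>2\<^sub>n\<^sub>+\<^sub>2 + c\<^sub>n + c\<^sub>n\<^sub>+\<^sub>1 = 1\<close> for all \<open>n\<close>.

  The substitution says \<open>c\<^sub>p\<^sub>m\<^sub>+\<^sub>i = v\<^sub>i + \<delta>\<^sub>i c\<^sub>m\<close>, where \<open>\<delta>\<^sub>i = 1\<close> means \<open>w\<^sub>i = -v\<^sub>i\<close>. Comparing this with the
  recurrence at \<open>n = p m + i\<close> forces \<open>\<delta>\<^sub>i = 1\<close> for all \<open>i\<close>. Hence \<open>f(z) = P(z) f(z\<^sup>p)\<close>, which is iterated.
\<close>

subsection \<open>Orthogonal polynomials over the field of two elements\<close>

definition moment :: "(nat \<Rightarrow> 'a::comm_semiring_0) \<Rightarrow> 'a poly \<Rightarrow> 'a"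
  where "moment s q = (\<Sum>i\<le>degree q. coeff q i * s i)"

lemma moment_eq_sum:
  assumes "\<And>i. i \<ge> n \<Longrightarrow> coeff q i = 0"
  shows "moment s q = (\<Sum>i<n. coeff q i * s i)"
proof -
  have "(\<Sum>i\<le>degree q. coeff q i * s i) = (\<Sum>i\<in>{..degree q} \<union> {..<n}. coeff q i * s i)"
    by (rule sum.mono_neutral_left) (auto simp: coeff_eq_0)
  also have "\<dots> = (\<Sum>i<n. coeff q i * s i)"
    by (rule sum.mono_neutral_right) (auto simp: assms)
  finally show ?thesis by (simp add: moment_def)
qed

lemma moment_0 [simp]: "moment s 0 = 0"
  by (simp add: moment_def)

lemma moment_add: "moment s (p + q) = moment s p + moment s q"
proof -
  define n where "n = Suc (max (degree p) (degree q))"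
  have "moment s p = (\<Sum>i<n. coeff p i * s i)" "moment s q = (\<Sum>i<n. coeff q i * s i)"
    "moment s (p + q) = (\<Sum>i<n. coeff (p + q) i * s i)"
    by (rule moment_eq_sum; simp add: n_def coeff_eq_0)+
  then show ?thesis by (simp add: distrib_right sum.distrib)
qed

lemma moment_add_left: "moment (\<lambda>k. s k + t k) q = moment s q + moment t q"
  by (simp add: moment_def distrib_left sum.distrib)

lemma moment_smult: "moment s (smult c q) = c * moment s q"
proof -
  have "moment s (smult c q) = (\<Sum>i<Suc (degree q). coeff (smult c q) i * s i)"
    by (rule moment_eq_sum) (simp add: coeff_eq_0)
  then show ?thesis
    by (simp add: moment_def lessThan_Suc_atMost sum_distrib_left mult.assoc)
qed

lemma moment_pCons: "moment s (pCons a q) = a * s 0 + moment (\<lambda>k. s (Suc k)) q"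
proof -
  have "moment s (pCons a q) = (\<Sum>i<Suc (Suc (degree q)). coeff (pCons a q) i * s i)"
    by (rule moment_eq_sum) (auto simp: coeff_pCons coeff_eq_0 split: nat.split)
  also have "\<dots> = a * s 0 + (\<Sum>i<Suc (degree q). coeff q i * s (Suc i))"
    by (subst sum.lessThan_Suc_shift) simp
  finally show ?thesis by (simp add: moment_def lessThan_Suc_atMost)
qed

lemma moment_monom_mult:
  "moment s (monom (1::'a::comm_semiring_1) j * q) = moment (\<lambda>k. s (k + j)) q"
  by (induction j arbitrary: s) (simp_all add: monom_0 monom_Suc moment_pCons)

lemma bit_add_self [simp]: "x + x = (0::bit)"
  by (cases x) simp_all

lemma bit_poly_add_self [simp]: "q + q = (0::bit poly)"
  by (rule poly_eqI) (simp only: coeff_add bit_add_self coeff_0)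

lemma bit_poly_add_self_left [simp]: "q + (q + r) = (r::bit poly)"
  by (simp flip: add.assoc)

lemma bit_poly_power2_add: "(p + q)\<^sup>2 = p\<^sup>2 + (q\<^sup>2 :: bit poly)"
proof -
  have "(p + q)\<^sup>2 = p\<^sup>2 + q\<^sup>2 + (p * q + p * q)"
    by (simp only: power2_eq_square algebra_simps)
  then show ?thesis by simp
qed

text \<open>Degree bounds are given by vanishing coefficients: such bounds are stable under addition
  and treat the zero polynomial uniformly.\<close>

definition orthogonal_poly :: "(nat \<Rightarrow> bit) \<Rightarrow> nat \<Rightarrow> bit poly \<Rightarrow> bool"
  where "orthogonal_poly s m a \<longleftrightarrow> coeff a m = 1 \<and> (\<forall>k>m. coeff a k = 0) \<and>
    (\<forall>q. (\<forall>k\<ge>m. coeff q k = 0) \<longrightarrow> moment s (a * q) = 0)"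

text \<open>In the nondegenerate case the norm quotient that usually multiplies
  \<open>orth s m\<close> is 1; signs disappear in characteristic 2.\<close>

fun orth :: "(nat \<Rightarrow> bit) \<Rightarrow> nat \<Rightarrow> bit poly"
  where
    "orth s 0 = 1"
  | "orth s (Suc 0) = [:s 1, 1:]"
  | "orth s (Suc (Suc m)) =
      smult (moment s (pCons 0 ((orth s (Suc m))\<^sup>2))) (orth s (Suc m)) +
      pCons 0 (orth s (Suc m)) + orth s m"

text \<open>Equivalent to all Hankel determinants of \<open>s\<close> being nonzero: the moments in
  question form the Hankel matrix of order \<open>degree a + 1\<close> applied to the coefficients
  of \<open>a\<close>.\<close>

locale nondegenerate_moments =
  fixes s :: "nat \<Rightarrow> bit"
  assumes nondegenerate: "a \<noteq> 0 \<Longrightarrow> \<exists>j\<le>degree a. moment s (monom 1 j * a) \<noteq> 0"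
begin

lemma moment_0_eq_1: "s 0 = 1"
  using nondegenerate[of 1] by (simp add: one_pCons moment_pCons monom_0)

text \<open>Removing \<open>coeff q m\<close> times \<open>a\<close> from \<open>q\<close> leaves
  degree below \<open>m\<close>, so only \<open>L(a^2)\<close> matters. It is nonzero, hence 1,
  since otherwise \<open>a\<close> would be orthogonal to all monomials up to its own
  degree.\<close>

lemma orthogonal_poly_moment:
  assumes a: "orthogonal_poly s m a" and q: "\<And>k. k > m \<Longrightarrow> coeff q k = 0"
  shows "moment s (a * q) = coeff q m"
proof -
  have expand: "moment s (a * q) = coeff q m * moment s (a * a)"
    if q: "\<And>k. k > m \<Longrightarrow> coeff q k = 0" for q
  proof -
    define r where "r = q + smult (coeff q m) a"
    have "coeff r k = 0" if "k \<ge> m" for k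
      using a q that by (cases "k = m") (auto simp: r_def orthogonal_poly_def)
    then have "moment s (a * r) = 0"
      using a by (auto simp: orthogonal_poly_def)
    moreover have "q = r + smult (coeff q m) a"
      by (simp add: r_def add.assoc)
    ultimately show ?thesis
      by (metis add_0 distrib_left moment_add moment_smult mult_smult_right)
  qed
  have "moment s (a * a) = 1"
  proof (rule ccontr)
    assume "moment s (a * a) \<noteq> 1"
    then have zero: "moment s (a * a) = 0" by simp
    have "a \<noteq> 0" using a by (auto simp: orthogonal_poly_def)
    moreover have "degree a = m"
      using a by (intro antisym degree_le le_degree) (auto simp: orthogonal_poly_def)
    ultimately obtain j where "j \<le> m" "moment s (monom 1 j * a) \<noteq> 0"
      using nondegenerate by blast
    with expand[of "monom 1 j"] zero show False by (simp add: mult.commute)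
  qed
  with expand[OF q] show ?thesis by simp
qed

text \<open>Split a test polynomial as \<open>r + t * a_(m+1)\<close> with \<open>r\<close> of
  degree at most \<open>m\<close>. On \<open>r\<close> the last two terms of the recurrence both
  give \<open>coeff r m\<close> and cancel; on \<open>a_(m+1)\<close> the first two cancel by the
  choice of the coefficient.\<close>

lemma orthogonal_poly_orth: "orthogonal_poly s m (orth s m)"
proof (induction m rule: induct_nat_012)
  case 0
  have "q = 0" if "\<forall>k. coeff q k = 0" for q :: "bit poly"
    using that by (simp add: poly_eq_iff)
  then have "moment s q = 0" if "\<forall>k. coeff q k = 0" for q
    using that by (metis moment_0)
  then show ?case by (simp add: orthogonal_poly_def)
next
  case 1
  have "moment s (orth s 1 * q) = 0" if "\<forall>k\<ge>1. coeff q k = 0" for q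
  proof -
    have "q = [:coeff q 0:]"
      using that by (auto simp: poly_eq_iff coeff_pCons split: nat.split)
    then obtain c where "q = [:c:]" by blast
    then show ?thesis by (simp add: moment_pCons moment_0_eq_1 mult.commute) blast
  qed
  then show ?case by (auto simp: orthogonal_poly_def coeff_pCons split: nat.split)
next
  case (ge2 m)
  let ?a = "orth s (Suc m)" and ?b = "orth s m" and ?c = "orth s (Suc (Suc m))"
  note ma = orthogonal_poly_moment[OF ge2(2)] and mb = orthogonal_poly_moment[OF ge2(1)]
  have cf: "coeff ?a (Suc m) = 1" "\<And>k. k > Suc m \<Longrightarrow> coeff ?a k = 0"
    "\<And>k. k > m \<Longrightarrow> coeff ?b k = 0"
    and ba: "\<And>q. (\<forall>k\<ge>Suc m. coeff q k = 0) \<Longrightarrow> moment s (?a * q) = 0"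
    using ge2 by (auto simp: orthogonal_poly_def)
  have c_mult: "moment s (?c * q) = moment s (pCons 0 (?a\<^sup>2)) * moment s (?a * q) +
      moment s (?a * pCons 0 q) + moment s (?b * q)" for q
    by (simp add: distrib_right moment_add moment_smult)
  have "moment s (?c * q) = 0" if q: "\<forall>k\<ge>Suc (Suc m). coeff q k = 0" for q
  proof -
    define t where "t = coeff q (Suc m)"
    define r where "r = q + smult t ?a"
    have r: "coeff r k = 0" if "k \<ge> Suc m" for k
      using q cf that by (cases "k = Suc m") (auto simp: r_def t_def)
    have "moment s (?a * r) = 0" using ba r by blast
    moreover have "moment s (?a * pCons 0 r) = coeff r m"
      using ma[of "pCons 0 r"] r by (auto simp: coeff_pCons split: nat.split)
    moreover have "moment s (?b * r) = coeff r m"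
      using mb[of r] r by simp
    ultimately have "moment s (?c * r) = 0"
      unfolding c_mult by simp
    moreover have "moment s (?c * ?a) = 0"
    proof -
      have "moment s (?a * ?a) = 1" using ma[of ?a] cf by simp
      moreover have "moment s (?b * ?a) = 0"
        using ba[of ?b] cf by (simp add: mult.commute)
      ultimately show ?thesis unfolding c_mult by (simp add: power2_eq_square)
    qed
    moreover have "q = r + smult t ?a" by (simp add: r_def add.assoc)
    ultimately show ?thesis
      by (metis add_0 distrib_left moment_add moment_smult mult_smult_right mult_zero_right)
  qed
  moreover have "coeff ?c (Suc (Suc m)) = 1" "\<forall>k>Suc (Suc m). coeff ?c k = 0"
    using cf by (auto simp: coeff_pCons split: nat.split)
  ultimately show ?case unfolding orthogonal_poly_def by blast
qed

lemma moment_orth_sq: "moment s ((orth s m)\<^sup>2) = 1"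
  using orthogonal_poly_moment[OF orthogonal_poly_orth, of m "orth s m"]
    orthogonal_poly_orth[of m] by (auto simp: orthogonal_poly_def power2_eq_square)

text \<open>For \<open>m > 0\<close> both sides are 0: the squared recurrence gives
  \<open>L(x^2 a_m^2) = 1 + \<alpha>^2 + 1 = \<alpha>\<close>, and \<open>a_m\<close> is orthogonal
  to 1. For \<open>m = 0\<close> the claim is \<open>L(a_1^2) = 1\<close>.\<close>

lemma moment_orth:
  "moment s (pCons 0 (pCons 0 ((orth s m)\<^sup>2))) + moment s (pCons 0 ((orth s m)\<^sup>2)) =
   moment s (orth s m)"
proof (cases m)
  case 0
  have "moment s ((orth s 1)\<^sup>2) = 1" by (rule moment_orth_sq)
  then have "s 1 * s 1 + s 2 = 1"
    by (simp add: power2_eq_square moment_pCons moment_0_eq_1 eval_nat_numeral)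
  with 0 show ?thesis
    by (simp add: moment_pCons moment_0_eq_1 eval_nat_numeral one_pCons)
next
  case (Suc k)
  define \<alpha> where "\<alpha> = moment s (pCons 0 ((orth s m)\<^sup>2))"
  have "orth s (Suc m) = smult \<alpha> (orth s m) + pCons 0 (orth s m) + orth s k"
    by (simp add: Suc \<alpha>_def)
  then have "pCons 0 (orth s m) = orth s (Suc m) + smult \<alpha> (orth s m) + orth s k"
    by (simp add: add_ac bit_poly_add_self_left)
  then have "(pCons 0 (orth s m))\<^sup>2 =
      (orth s (Suc m))\<^sup>2 + smult (\<alpha>\<^sup>2) ((orth s m)\<^sup>2) + (orth s k)\<^sup>2"
    by (simp only: bit_poly_power2_add smult_power)
  moreover have "(pCons 0 (orth s m))\<^sup>2 = pCons 0 (pCons 0 ((orth s m)\<^sup>2))"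
    by (simp add: power2_eq_square)
  ultimately have "moment s (pCons 0 (pCons 0 ((orth s m)\<^sup>2))) = 1 + \<alpha>\<^sup>2 + 1"
    by (simp only: moment_add moment_smult moment_orth_sq mult_1_right)
  also have "\<dots> = \<alpha>" by (cases \<alpha>) simp_all
  finally have "moment s (pCons 0 (pCons 0 ((orth s m)\<^sup>2))) + \<alpha> = 0" by simp
  moreover have "moment s (orth s m * 1) = coeff 1 m"
    by (rule orthogonal_poly_moment[OF orthogonal_poly_orth]) simp
  ultimately show ?thesis using Suc by (simp add: \<alpha>_def)
qed

text \<open>Squaring is additive, so both sides are additive in \<open>q\<close>; cancelling the
  leading term with \<open>orth s n\<close> reduces the claim to \<open>moment_orth\<close>.\<close>

lemma moment_frobenius:
  "moment s (pCons 0 (pCons 0 (q\<^sup>2))) + moment s (pCons 0 (q\<^sup>2)) = moment s q"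
proof -
  have "?thesis" if "\<And>k. k \<ge> n \<Longrightarrow> coeff q k = 0" for n
    using that
  proof (induction n arbitrary: q)
    case 0
    then have "q = 0" by (simp add: poly_eq_iff)
    then show ?case by simp
  next
    case (Suc n)
    show ?case
    proof (cases "coeff q n = 0")
      case True
      with Suc show ?thesis by (metis le_neq_implies_less Suc_leI)
    next
      case False
      define r where "r = q + orth s n"
      have "coeff r k = 0" if "k \<ge> n" for k
        using Suc.prems False that orthogonal_poly_orth[of n]
        by (cases "k = n") (auto simp: r_def orthogonal_poly_def)
      then have "moment s (pCons 0 (pCons 0 (r\<^sup>2))) + moment s (pCons 0 (r\<^sup>2)) = moment s r"
        by (rule Suc.IH)
      moreover have "q = r + orth s n" by (simp add: r_def add.assoc)
      moreover have "pCons 0 (x + y) = pCons 0 x + pCons 0 y" for x y :: "bit poly" by simp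
      ultimately show ?thesis
        using moment_orth[of n]
        by (simp only: bit_poly_power2_add moment_add add_ac)
    qed
  qed
  from this[of "Suc (degree q)"] show ?thesis by (simp add: coeff_eq_0)
qed

lemma moment_recurrence: "s (2 * n + 2) + s (2 * n + 1) = s n"
proof -
  have m: "moment t (monom 1 k) = t k" for t :: "nat \<Rightarrow> bit" and k
    using moment_monom_mult[of t k 1] by (simp add: moment_def)
  show ?thesis
    using moment_frobenius[of "monom 1 n"]
    by (simp add: monom_power moment_pCons m mult.commute)
qed

end

subsection \<open>The recurrence of apwenian sequences\<close>

definition sign_bit :: "int \<Rightarrow> bit"
  where "sign_bit x = of_bool (x = -1)"

lemma of_int_bit: "of_int x = (of_bool (odd x) :: bit)"
  by (cases "even x") (auto elim!: evenE oddE)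

lemma sign_bit_diff:
  assumes "x \<in> {-1, 1}" "y \<in> {-1, 1}"
  shows "of_int ((x - y) div 2) = sign_bit x + sign_bit y"
  using assms by (auto simp: sign_bit_def of_int_bit)

lemma apwenian_nondegenerate:
  assumes "apwenian d"
  shows "nondegenerate_moments (\<lambda>k. sign_bit (d k) + sign_bit (d (k + 2)))"
proof
  fix a :: "bit poly"
  assume "a \<noteq> 0"
  define c where "c k = sign_bit (d k)" for k
  \<comment> \<open>Two more than the degree: \<open>U\<close> below has degree
    \<open>degree a + 1\<close>, hence \<open>n\<close> coefficients.\<close>
  define n where "n = Suc (Suc (degree a))"
  define B where "B = mat n n
    (\<lambda>(i, j). if i = 0 then d j else (d (i + j) - d (i + j - 1)) div 2)"
  \<comment> \<open>\<open>T\<close> undoes the row differences and the halving that lead from the Hankel matrix to \<open>B\<close>.\<close>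
  define T where "T = mat n n (\<lambda>(i, l). if l = 0 then 1 else if l \<le> i then 2 else 0 :: int)"
  define B' where "B' = map_mat (of_int :: int \<Rightarrow> bit) B"
  have d: "d k \<in> {-1, 1}" for k
    using assms by (auto simp: apwenian_def)
  have carrier: "B \<in> carrier_mat n n" "T \<in> carrier_mat n n" "B' \<in> carrier_mat n n"
    by (simp_all add: B_def T_def B'_def)
  have "mat n n (\<lambda>(i, j). d (i + j)) = T * B"
  proof (rule eq_matI)
    fix i j assume "i < dim_row (T * B)" "j < dim_col (T * B)"
    then have ij: "i < n" "j < n" using carrier by auto
    have even: "2 * ((d x - d y) div 2) = d x - d y" for x y
      using d[of x] d[of y] by auto
    have "(T * B) $$ (i, j) = (\<Sum>l<n. T $$ (i, l) * B $$ (l, j))"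
      using ij carrier by (simp add: scalar_prod_def lessThan_atLeast0)
    also have "\<dots> = (\<Sum>l<n. if l \<le> i then if l = 0 then d j else d (l + j) - d (l + j - 1) else 0)"
      using ij by (intro sum.cong) (auto simp: T_def B_def even)
    also have "\<dots> = (\<Sum>l\<le>i. if l = 0 then d j else d (l + j) - d (l + j - 1))"
      using ij by (intro sum.mono_neutral_cong_right) auto
    also have "\<dots> = d (i + j)"
      by (induction i) simp_all
    finally show "mat n n (\<lambda>(i, j). d (i + j)) $$ (i, j) = (T * B) $$ (i, j)"
      using ij by simp
  qed (use carrier in auto)
  then have "hankel_det d n = Determinant.det T * Determinant.det B"
    unfolding hankel_det_def using carrier by (simp add: det_mult)
  moreover have "Determinant.det T = 2 ^ (n - 1)"
  proof -
    have "Determinant.det T = prod_list (diag_mat T)"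
      by (rule det_lower_triangular[of n]) (auto simp: T_def)
    also have "\<dots> = (\<Prod>i<n. if i = 0 then 1 else 2)"
      unfolding prod_list_diag_prod using carrier
      by (auto simp: T_def lessThan_atLeast0 intro!: prod.cong)
    also have "\<dots> = 2 ^ (n - 1)"
      unfolding n_def by (subst prod.lessThan_Suc_shift) simp
    finally show ?thesis .
  qed
  ultimately have "hankel_det d n div 2 ^ (n - 1) = Determinant.det B"
    by simp
  moreover have "[hankel_det d n div 2 ^ (n - 1) = 1] (mod 2)"
    using assms unfolding apwenian_def n_def by (metis Suc_le_mono le0 One_nat_def)
  ultimately have "odd (Determinant.det B)"
    by (simp add: cong_def odd_iff_mod_2_eq_one)
  then have "Determinant.det B' \<noteq> 0"
    by (simp add: B'_def of_int_hom.hom_det of_int_bit)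
  then have ker: "B' *\<^sub>v u \<noteq> 0\<^sub>v n" if "u \<in> carrier_vec n" "u \<noteq> 0\<^sub>v n" for u
    using det_0_iff_vec_prod_zero_field[OF carrier(3)] that by blast
  \<comment> \<open>Multiplying by \<open>1 + x\<close> plays the role of the column differences.\<close>
  define U where "U = a + pCons 0 a"
  have U: "coeff U k = 0" if "k \<ge> n" for k
    using that by (auto simp: U_def n_def coeff_eq_0 coeff_pCons split: nat.split)
  have "coeff U (Suc (degree a)) \<noteq> 0"
    using \<open>a \<noteq> 0\<close> by (simp add: U_def coeff_eq_0)
  then have "vec n (coeff U) \<noteq> 0\<^sub>v n"
    by (metis index_vec index_zero_vec(1) lessI n_def)
  then have "B' *\<^sub>v vec n (coeff U) \<noteq> 0\<^sub>v n"
    by (intro ker) auto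
  then obtain l where l: "l < n" "(B' *\<^sub>v vec n (coeff U)) $ l \<noteq> 0"
    using carrier by (metis carrier_matD(1) dim_mult_mat_vec eq_vecI index_zero_vec)
  have row: "(B' *\<^sub>v vec n (coeff U)) $ l = moment r U"
    if "\<And>j. j < n \<Longrightarrow> B' $$ (l, j) = r j" for r
  proof -
    have "moment r U = (\<Sum>j<n. coeff U j * r j)"
      by (rule moment_eq_sum) (rule U)
    then show ?thesis
      using l(1) carrier that by (simp add: scalar_prod_def lessThan_atLeast0 mult.commute
        del: mult_bit_eq_and)
  qed
  have mU: "moment r U = moment (\<lambda>j. r j + r (Suc j)) a" for r
    by (simp only: U_def moment_add moment_pCons moment_add_left mult_zero_left add_0)
  \<comment> \<open>Row 0 of \<open>B'\<close> is all ones, so it evaluates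
    \<open>U = (1 + x) a\<close> at 1, which gives 0.\<close>
  have "l \<noteq> 0"
  proof
    assume "l = 0"
    have "(of_int (d j) :: bit) = 1" for j
      using d[of j] by (auto simp: of_int_bit)
    then have "(B' *\<^sub>v vec n (coeff U)) $ l = moment (\<lambda>j. 1) U"
      using l by (intro row) (simp add: B'_def B_def \<open>l = 0\<close>)
    also have "\<dots> = 0" unfolding mU bit_add_self by (simp only: moment_def mult_zero_right sum.neutral_const)
    finally show False using l by simp
  qed
  then obtain i where i: "l = Suc i" using not0_implies_Suc by blast
  \<comment> \<open>The factor \<open>1 + x\<close> adds neighbouring entries of the row; the middle
    terms cancel.\<close>
  have "(B' *\<^sub>v vec n (coeff U)) $ l = moment (\<lambda>j. c (j + l) + c (j + i)) U"
    using l sign_bit_diff[OF d d] by (intro row) (simp add: B'_def B_def c_def i add_ac)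
  also have "\<dots> = moment (\<lambda>j. c (j + i) + c (j + i + 2)) a"
    unfolding mU by (rule arg_cong2[of _ _ _ _ moment]) (auto simp: i add_ac fun_eq_iff)
  also have "\<dots> = moment (\<lambda>k. c k + c (k + 2)) (monom 1 i * a)"
    by (simp add: moment_monom_mult add_ac)
  finally have "moment (\<lambda>k. c k + c (k + 2)) (monom 1 i * a) \<noteq> 0"
    using l(2) by simp
  moreover have "i \<le> degree a" using l(1) i by (simp add: n_def)
  ultimately show "\<exists>j\<le>degree a.
      moment (\<lambda>k. sign_bit (d k) + sign_bit (d (k + 2))) (monom 1 j * a) \<noteq> 0"
    unfolding c_def by blast
qed

text \<open>By \<open>moment_recurrence\<close> the left side takes the same value at
  \<open>n\<close> and \<open>n + 1\<close>; at \<open>n = 0\<close> it is \<open>c 0 + c 2\<close>,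
  the zeroth moment.\<close>

lemma apwenian_recurrence:
  assumes "apwenian d"
  defines "c \<equiv> \<lambda>k. sign_bit (d k)"
  shows "c (2 * n + 1) + c (2 * n + 2) + c n + c (n + 1) = 1"
proof -
  interpret nondegenerate_moments "\<lambda>k. c k + c (k + 2)"
    unfolding c_def by (rule apwenian_nondegenerate[OF assms(1)])
  show ?thesis
  proof (induction n)
    case 0
    have "c 0 + c 2 = 1" using moment_0_eq_1 by (simp only: add_0)
    then show ?case by (cases "c 0"; cases "c 1"; cases "c 2"; simp add: numeral_2_eq_2)
  next
    case (Suc n)
    have idx: "2 * n + 2 + 2 = 2 * n + 4" "2 * n + 1 + 2 = 2 * n + 3"
      "2 * (n + 1) + 1 = 2 * n + 3" "2 * (n + 1) + 2 = 2 * n + 4" "n + 1 + 1 = n + 2"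
      by simp_all
    have "c (2 * n + 2) + c (2 * n + 4) + (c (2 * n + 1) + c (2 * n + 3)) = c n + c (n + 2)"
      using moment_recurrence[of n] unfolding idx .
    with Suc have "c (2 * n + 3) + c (2 * n + 4) + c (n + 1) + c (n + 2) = 1"
      by (cases "c n"; cases "c (n + 1)"; cases "c (n + 2)"; cases "c (2 * n + 1)";
          cases "c (2 * n + 2)"; cases "c (2 * n + 3)"; cases "c (2 * n + 4)"; simp)
    then show ?case unfolding Suc_eq_plus1 idx .
  qed
qed

subsection \<open>Substitutions compatible with the recurrence\<close>

lemma bit_add_self_left: "x + (x + y) = (y::bit)"
  by (cases x) simp_all

lemma bit_affine_coeff_eq_0:
  fixes x y :: "nat \<Rightarrow> bit"
  assumes "\<And>m. A + B * x m + C * y m = 0"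
    and "\<And>k. \<not> (\<forall>m. y m = k)" and "\<And>k. \<not> (\<forall>m. x m = y m + k)"
  shows "C = 0"
proof (rule ccontr)
  assume "C \<noteq> 0"
  then have C: "C = 1" by simp
  show False
  proof (cases B)
    assume "B = 0"
    have "y m = A" for m using assms(1)[of m] C \<open>B = 0\<close> by (cases A; cases "y m"; simp)
    with assms(2) show False by blast
  next
    assume "B = 1"
    have "x m = y m + A" for m
      using assms(1)[of m] C \<open>B = 1\<close> by (cases A; cases "y m"; cases "x m"; simp)
    with assms(3) show False by blast
  qed
qed

locale bit_substitution =
  fixes c v \<delta> :: "nat \<Rightarrow> bit" and p :: nat
  assumes p: "p \<ge> 2"
    and rec: "c (2 * n + 1) + c (2 * n + 2) + c n + c (n + 1) = 1"
    and sub: "i < p \<Longrightarrow> c (p * m + i) = v i + \<delta> i * c m"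
begin

text \<open>Four equal bits sum to 0, against the recurrence at 1. Index 0 is left out because the
  exceptional case below controls only positive indices.\<close>

lemma not_constant: "\<not> (\<forall>m. c (Suc m) = k)"
proof
  assume "\<forall>m. c (Suc m) = k"
  then have "c 1 = k" "c 2 = k" "c 3 = k" "c 4 = k"
    by (simp_all add: eval_nat_numeral)
  with rec[of 1] show False by (cases k; simp add: eval_nat_numeral)
qed

text \<open>The recurrence of \<open>c\<close> at the last letter \<open>n = p m + (p - 1)\<close> of a block.\<close>

lemma boundary:
  "\<delta> (p - 1) * (c (2 * m + 1) + c m) + \<delta> 0 * (c (2 * m + 2) + c (m + 1)) = 1"
proof -
  let ?n = "p * m + (p - 1)"
  have n: "2 * ?n + 1 = p * (2 * m + 1) + (p - 1)" "2 * ?n + 2 = p * (2 * m + 2) + 0"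
    "?n + 1 = p * (m + 1) + 0"
    using p by (simp_all add: algebra_simps)
  have "p - 1 < p" "0 < p" using p by simp_all
  note s = sub[OF this(1)] sub[OF this(2)]
  \<comment> \<open>The bits \<open>v (p - 1)\<close> and \<open>v 0\<close> occur twice each and
    cancel.\<close>
  show ?thesis
    using rec[of ?n] unfolding n s
    by (simp only: distrib_left add_ac bit_add_self bit_add_self_left)
qed

text \<open>Neither pair \<open>n, n + 1\<close> nor \<open>2n + 1, 2n + 2\<close> crosses a block
  border for \<open>n = p m + i\<close>. The recurrence is then affine in
  \<open>c (2 * m + q)\<close> and \<open>c m\<close>, and independence kills the coefficient of
  \<open>c m\<close>.\<close>

lemma step:
  assumes i: "i + 1 < p" and t: "t + 1 < p" and it: "2 * i + 1 = p * q + t"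
    and indep: "\<And>k. \<not> (\<forall>m. c (2 * m + q) = c m + k)"
  shows "\<delta> i = \<delta> (i + 1)"
proof -
  have "\<delta> i + \<delta> (i + 1) = 0"
  proof (rule bit_affine_coeff_eq_0[OF _ _ indep])
    fix m
    let ?n = "p * m + i"
    have n: "2 * ?n + 1 = p * (2 * m + q) + t" "2 * ?n + 2 = p * (2 * m + q) + (t + 1)"
      "?n + 1 = p * m + (i + 1)"
      using it by (simp_all add: algebra_simps)
    have lt: "i < p" "t < p" using i t by simp_all
    note s = sub[OF i] sub[OF t] sub[OF lt(1)] sub[OF lt(2)]
    have "(v t + v (t + 1) + v i + v (i + 1) + 1) + (\<delta> t + \<delta> (t + 1)) * c (2 * m + q) +
        (\<delta> i + \<delta> (i + 1)) * c m = (c (2 * ?n + 1) + c (2 * ?n + 2) + c ?n + c (?n + 1)) + 1"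
      unfolding n s by (simp only: distrib_right add_ac)
    then show "(v t + v (t + 1) + v i + v (i + 1) + 1) + (\<delta> t + \<delta> (t + 1)) * c (2 * m + q) +
        (\<delta> i + \<delta> (i + 1)) * c m = 0"
      unfolding rec by simp
    show "\<not> (\<forall>m. c m = k)" for k using not_constant by blast
  qed
  then show ?thesis by (cases "\<delta> i"; cases "\<delta> (i + 1)"; simp)
qed

text \<open>
  The exceptional sequences, such as Thue-Morse: here \<open>\<delta>\<^sub>j = \<delta>\<^bsub>j div 2\<^esub>\<close>, so \<open>\<delta>\<close> is constant.
\<close>

lemma digits_all_flip_affine:
  assumes odd: "\<And>m. c (2 * m + 1) = c m + k" and "j < p"
  shows "\<delta> j = 1"
proof -
  have even: "c (2 * m + 2) = c (m + 1) + (1 + k)" for m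
    using rec[of m] odd[of m]
    by (cases "c m"; cases k; cases "c (m + 1)"; cases "c (2 * m + 2)"; simp)
  \<comment> \<open>Position \<open>p (2m) + j\<close> is \<open>2 (p m + j div 2)\<close> plus the
    parity of \<open>j\<close>. Expanding by blocks and by \<open>odd\<close> or \<open>even\<close>
    gives an equation in \<open>c m\<close> alone; unequal \<delta> would make \<open>c\<close>
    constant on positive indices.\<close>
  have half: "\<delta> j = \<delta> (j div 2)" if "j < p" for j
  proof (rule ccontr)
    assume neq: "\<delta> j \<noteq> \<delta> (j div 2)"
    define i where "i = j div 2"
    have "i < p" using that by (simp add: i_def)
    define K where "K = (if even j then 1 + k else k)"
    have "c (Suc m) = v j + \<delta> j * (1 + k) + v i + K" for m
    proof -
      let ?m = "Suc m"
      have "0 < p * ?m + i" using p by simp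
      then obtain n where n: "p * ?m + i = n + 1" by (metis Suc_eq_plus1 gr0_implies_Suc)
      have "c (p * (2 * ?m) + j) = c (p * ?m + i) + K"
      proof (cases "even j")
        case True
        then have "p * (2 * ?m) + j = 2 * n + 2"
          using n by (auto simp: i_def elim!: evenE)
        then show ?thesis using True even[of n] n by (simp add: K_def)
      next
        case False
        then have "p * (2 * ?m) + j = 2 * (n + 1) + 1"
          using n by (auto simp: i_def elim!: oddE)
        then show ?thesis using False odd[of "n + 1"] n by (simp add: K_def)
      qed
      then have "v j + \<delta> j * c (2 * ?m) = v i + \<delta> i * c ?m + K"
        unfolding sub[OF \<open>j < p\<close>] sub[OF \<open>i < p\<close>] .
      moreover have "c (2 * ?m) = c ?m + (1 + k)" using even[of m] by simp
      moreover have "\<delta> i = \<delta> j + 1" using neq by (cases "\<delta> j"; cases "\<delta> i"; simp add: i_def)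
      ultimately show ?thesis
        by (cases "c ?m"; cases "v i"; cases "v j"; cases "\<delta> j"; cases k; cases K; simp)
    qed
    then show False using not_constant by blast
  qed
  have const: "\<delta> j = \<delta> 0" if "j < p" for j
    using that
  proof (induction j rule: less_induct)
    case (less j)
    show ?case
    proof (cases "j = 0")
      case False
      then have "\<delta> (j div 2) = \<delta> 0" using less.IH[of "j div 2"] less.prems by simp
      with half[OF \<open>j < p\<close>] show ?thesis by simp
    qed simp
  qed
  have "\<delta> (p - 1) = \<delta> 0" by (rule const) (use p in simp)
  with boundary[of 0] have "\<delta> 0 = 1" by (cases "\<delta> 0"; simp)
  then show ?thesis using const[OF \<open>j < p\<close>] by simp
qed

text \<open>Outside the exceptional case \<open>step\<close> applies with \<open>q = 0\<close> and
  \<open>q = 1\<close>. It carries the value 1 from the two ends of the block to the middle.\<close>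

lemma digits_all_flip:
  assumes "j < p"
  shows "\<delta> j = 1"
proof (cases "\<exists>k. \<forall>m. c (2 * m + 1) = c m + k")
  case True
  with digits_all_flip_affine assms show ?thesis by blast
next
  case False
  have even: "\<not> (\<forall>m. c (2 * m + 0) = c m + k)" for k
  proof
    assume *: "\<forall>m. c (2 * m + 0) = c m + k"
    have "c (2 * m + 1) = c m + (1 + k)" for m
      using rec[of m] *[rule_format, of "m + 1"]
      by (cases "c m"; cases k; cases "c (m + 1)"; cases "c (2 * m + 1)"; simp)
    with False show False by blast
  qed
  \<comment> \<open>Otherwise \<open>boundary\<close> and the recurrence would make \<open>c (2 * m + 1) + c m\<close> constant.\<close>
  have ends: "\<delta> 0 = 1 \<and> \<delta> (p - 1) = 1"
  proof (rule ccontr)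
    assume neg: "\<not> (\<delta> 0 = 1 \<and> \<delta> (p - 1) = 1)"
    have "\<exists>k. \<forall>m. c (2 * m + 1) = c m + k"
    proof (cases "\<delta> (p - 1)")
      assume 0: "\<delta> (p - 1) = 0"
      have "c (2 * m + 1) = c m + 0" for m
        using boundary[of m] rec[of m] 0
        by (cases "c m"; cases "c (2 * m + 1)"; cases "c (m + 1)"; cases "c (2 * m + 2)";
            cases "\<delta> 0"; simp)
      then show ?thesis by blast
    next
      assume 1: "\<delta> (p - 1) = 1"
      have "c (2 * m + 1) = c m + 1" for m
        using boundary[of m] rec[of m] 1 neg
        by (cases "c m"; cases "c (2 * m + 1)"; cases "\<delta> 0"; simp)
      then show ?thesis by blast
    qed
    with False show False by blast
  qed
  have low: "\<delta> i = 1" if "2 * i < p" for i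
    using that
  proof (induction i)
    case (Suc i)
    have "\<delta> i = \<delta> (i + 1)"
      by (rule step[of i "2 * i + 1" 0]) (use Suc.prems even in auto)
    with Suc show ?case by simp
  qed (use ends in simp)
  \<comment> \<open>Here \<open>j\<close> is the distance from the last index, so the induction
    descends from \<open>p - 1\<close>; the doubled positions lie in block
    \<open>2 * m + 1\<close>.\<close>
  have high: "j < p \<Longrightarrow> p \<le> 2 * (p - 1 - j) + 1 \<Longrightarrow> \<delta> (p - 1 - j) = 1" for j
  proof (induction j)
    case (Suc j)
    have "\<delta> (p - 1 - Suc j) = \<delta> (p - 1 - Suc j + 1)"
      by (rule step[of _ "2 * (p - 1 - Suc j) + 1 - p" 1]) (use Suc.prems False in auto)
    with Suc show ?case by (simp add: Suc_diff_Suc)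
  qed (use ends in simp)
  show ?thesis
  proof (cases "2 * j < p")
    case True
    then show ?thesis by (rule low)
  next
    case False
    with high[of "p - 1 - j"] assms show ?thesis by simp
  qed
qed

end

subsection \<open>The infinite product\<close>

lemma nth_concat_uniform:
  assumes "\<And>x. x \<in> set xs \<Longrightarrow> length x = p" "k < length xs" "i < p"
  shows "concat xs ! (p * k + i) = xs ! k ! i"
  using assms
proof (induction xs arbitrary: k)
  case (Cons x xs)
  then show ?case by (cases k) (auto simp: nth_append add.assoc)
qed simp

text \<open>Take \<open>n\<close> so large that position \<open>m\<close> of the \<open>n\<close>-th
  word and position \<open>p * m + i\<close> of the next one already carry their limit
  letters.\<close>

lemma words_tendsto_substitution:
  assumes \<sigma>: "\<And>x. x \<in> A \<Longrightarrow> length (\<sigma> x) = p \<and> set (\<sigma> x) \<subseteq> A" and "a \<in> A"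
    and lim: "words_tendsto (\<lambda>n. (subst_ext \<sigma> ^^ n) [a]) d" and "i < p"
  shows "d (p * m + i) = \<sigma> (d m) ! i"
proof -
  let ?W = "\<lambda>n. (subst_ext \<sigma> ^^ n) [a]"
  have letters: "set (?W n) \<subseteq> A" for n
  proof (induction n)
    case (Suc n)
    then show ?case using \<sigma> by (fastforce simp: subst_ext_def)
  qed (use \<open>a \<in> A\<close> in simp)
  have "\<forall>\<^sub>F n in sequentially. m < length (?W n) \<and> ?W n ! m = d m"
    using lim by (simp add: words_tendsto_def)
  moreover have "\<forall>\<^sub>F n in sequentially. ?W (Suc n) ! (p * m + i) = d (p * m + i)"
    using lim unfolding words_tendsto_def
    by (subst eventually_sequentially_Suc) (auto elim: eventually_mono)
  ultimately have "\<forall>\<^sub>F n in sequentially. m < length (?W n) \<and> ?W n ! m = d m \<and>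
      ?W (Suc n) ! (p * m + i) = d (p * m + i)"
    by eventually_elim simp
  then obtain n where n: "m < length (?W n)" "?W n ! m = d m"
    "?W (Suc n) ! (p * m + i) = d (p * m + i)"
    using eventually_happens'[OF sequentially_bot] by blast
  have "?W (Suc n) = concat (map \<sigma> (?W n))"
    by (simp add: subst_ext_def)
  moreover have "concat (map \<sigma> (?W n)) ! (p * m + i) = map \<sigma> (?W n) ! m ! i"
  proof (rule nth_concat_uniform)
    fix x assume "x \<in> set (map \<sigma> (?W n))"
    then obtain y where "y \<in> set (?W n)" "x = \<sigma> y" by auto
    then show "length x = p" using \<sigma>[of y] letters[of n] by blast
  qed (use n(1) \<open>i < p\<close> in simp_all)
  ultimately show ?thesis using n by simp
qed

section \<open>Power series in a power of the variable\<close>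

lemma fps_nth_compose_X_power:
  fixes f :: "'a::idom fps"
  assumes "q > 0"
  shows "fps_nth (f oo fps_X ^ q) n = (if q dvd n then fps_nth f (n div q) else 0)"
proof -
  have "fps_nth (f oo fps_X ^ q) n = (\<Sum>i=0..n. if n = q * i then fps_nth f i else 0)"
    unfolding fps_compose_nth power_mult[symmetric]
    by (intro sum.cong) auto
  also have "\<dots> = (if q dvd n then fps_nth f (n div q) else 0)"
  proof (cases "q dvd n")
    case True
    then obtain k where "n = q * k" by blast
    with assms show ?thesis by simp
  next
    case False
    then have "n \<noteq> q * i" for i by auto
    with False show ?thesis by simp
  qed
  finally show ?thesis .
qed

lemma fps_eq_mult_compose_power:
  fixes d v :: "nat \<Rightarrow> 'a::idom"
  assumes "p > 0" and d: "\<And>m i. i < p \<Longrightarrow> d (p * m + i) = v i * d m"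
  shows "Abs_fps d = (\<Sum>i<p. fps_const (v i) * fps_X ^ i) * (Abs_fps d oo fps_X ^ p)"
proof (rule fps_ext)
  fix n
  let ?P = "\<Sum>i<p. fps_const (v i) * fps_X ^ i" and ?g = "Abs_fps d oo fps_X ^ p"
  have P: "fps_nth ?P i = (if i < p then v i else 0)" for i
    by (simp add: fps_sum_nth if_distrib cong: if_cong)
  have "fps_nth (?P * ?g) n = (\<Sum>i=0..n. fps_nth ?P i * fps_nth ?g (n - i))"
    by (rule fps_mult_nth)
  \<comment> \<open>A nonzero term needs \<open>i < p\<close> and \<open>p dvd n - i\<close>, that
    is, \<open>i = n mod p\<close>.\<close>
  also have "\<dots> = (\<Sum>i\<in>{n mod p}. fps_nth ?P i * fps_nth ?g (n - i))"
  proof (rule sum.mono_neutral_right)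
    show "\<forall>i\<in>{0..n} - {n mod p}. fps_nth ?P i * fps_nth ?g (n - i) = 0"
    proof
      fix i assume i: "i \<in> {0..n} - {n mod p}"
      show "fps_nth ?P i * fps_nth ?g (n - i) = 0"
      proof (cases "i < p \<and> p dvd n - i")
        case True
        then have "n mod p = i mod p" using i
          by (metis DiffD1 atLeastAtMost_iff mod_eq_dvd_iff_nat)
        with True i show ?thesis by simp
      next
        case False
        then show ?thesis using \<open>p > 0\<close> by (auto simp: P fps_nth_compose_X_power)
      qed
    qed
  qed auto
  also have "\<dots> = v (n mod p) * d (n div p)"
    using \<open>p > 0\<close> by (simp add: P fps_nth_compose_X_power minus_mod_eq_mult_div)
  also have "\<dots> = d n"
    using d[of "n mod p" "n div p"] \<open>p > 0\<close> by simp
  finally show "fps_nth (Abs_fps d) n = fps_nth (?P * ?g) n" by simp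
qed

text \<open>Iteration leaves the remainder \<open>f(z^(p^(n+1)))\<close>, which is 1 up to degree
  \<open>n\<close>; the partial product thus agrees with \<open>f\<close> there.\<close>

lemma has_prod_compose_power:
  fixes f P :: "'a::idom fps"
  assumes "p \<ge> 2" and f: "f = P * (f oo fps_X ^ p)" and f0: "fps_nth f 0 = 1"
  shows "(\<lambda>i. P oo fps_X ^ (p ^ i)) has_prod f"
proof -
  let ?Q = "\<lambda>n. \<Prod>i\<le>n. P oo fps_X ^ (p ^ i)"
  have pos: "0 < p ^ n" for n using \<open>p \<ge> 2\<close> by simp
  have step: "f oo fps_X ^ (p ^ n) = (P oo fps_X ^ (p ^ n)) * (f oo fps_X ^ (p ^ Suc n))" for n
  proof -
    have X0: "fps_nth (fps_X ^ q :: 'a fps) 0 = 0" if "q > 0" for q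
      using that by simp
    have "f oo fps_X ^ (p ^ n) = (P oo fps_X ^ (p ^ n)) * (f oo fps_X ^ p oo fps_X ^ (p ^ n))"
      by (subst f) (rule fps_compose_mult_distrib[OF X0[OF pos]])
    also have "f oo fps_X ^ p oo fps_X ^ (p ^ n) = f oo (fps_X ^ p oo fps_X ^ (p ^ n))"
      using \<open>p \<ge> 2\<close> by (intro fps_compose_assoc[symmetric] X0) auto
    also have "fps_X ^ p oo fps_X ^ (p ^ n) = (fps_X ^ (p ^ Suc n) :: 'a fps)"
      using X0[OF pos] by (simp add: fps_X_power_compose power_mult[symmetric] mult.commute)
    finally show ?thesis .
  qed
  have partial: "f = ?Q n * (f oo fps_X ^ (p ^ Suc n))" for n
  proof (induction n)
    case 0
    show ?case using f by simp
  next
    case (Suc n)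
    then show ?case using step[of "Suc n"] by (simp add: mult.assoc)
  qed
  have "fps_nth (?Q n) k = fps_nth f k" if "n \<ge> k" for n k
  proof -
    have "k < p ^ Suc n"
      using that \<open>p \<ge> 2\<close> by (metis less_exp le_SucI le_less_trans order_less_le_trans power_mono zero_le)
    have g: "fps_nth (f oo fps_X ^ (p ^ Suc n)) j = (if j = 0 then 1 else 0)" if "j \<le> k" for j
    proof -
      have "j < p ^ Suc n" using that \<open>k < p ^ Suc n\<close> by simp
      then show ?thesis
        by (subst fps_nth_compose_X_power[OF pos]) (auto simp: f0 dest: dvd_imp_le)
    qed
    have "fps_nth f k = (\<Sum>i=0..k. fps_nth (?Q n) i * fps_nth (f oo fps_X ^ (p ^ Suc n)) (k - i))"
      by (subst partial[of n]) (rule fps_mult_nth)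
    also have "\<dots> = (\<Sum>i=0..k. if i = k then fps_nth (?Q n) k else 0)"
      by (intro sum.cong refl) (subst g, auto)
    finally show ?thesis by simp
  qed
  then have "?Q \<longlonglongrightarrow> f"
    by (intro tendsto_fpsI) (auto simp: eventually_sequentially)
  \<comment> \<open>\<open>has_prod\<close> with no factors skipped demands a nonzero limit.\<close>
  moreover have "f \<noteq> 0" using f0 by auto
  ultimately show ?thesis by (simp add: has_prod_def raw_has_prod_def)
qed

theorem theorem1p2:
  fixes p :: nat
    and \<sigma> :: "int \<Rightarrow> int list"
    and v w d :: "nat \<Rightarrow> int"
    and f P :: "int fps"
  assumes "p \<ge> 2"
    and "\<And>i. i < p \<Longrightarrow> v i \<in> {-1, 1}"
    and "\<And>i. i < p \<Longrightarrow> w i \<in> {-1, 1}"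
    and "v 0 = 1"
    and "\<sigma> 1 = map v [0..<p]"
    and "\<sigma> (-1) = map w [0..<p]"
    and "words_tendsto (\<lambda>n. (subst_ext \<sigma> ^^ n) [1]) d"
    and "f = Abs_fps d"
    and "P = (\<Sum>i<p. fps_const (v i) * fps_X ^ i)"
    and "apwenian d"
  shows "(\<lambda>i. P oo fps_X ^ (p ^ i)) has_prod f"
proof -
  have d: "d k \<in> {-1, 1}" for k
    using \<open>apwenian d\<close> by (simp add: apwenian_def)
  have fixp: "d (p * m + i) = (if d m = 1 then v i else w i)" if "i < p" for m i
  proof -
    have "d (p * m + i) = \<sigma> (d m) ! i"
      by (rule words_tendsto_substitution[where A = "{-1, 1}", OF _ _ assms(7) that])
        (use assms(2,3,5,6) in fastforce)+
    then show ?thesis using d[of m] assms(5,6) that by auto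
  qed
  \<comment> \<open>The bit \<open>v + (v + w) c\<close> is \<open>v\<close> for
    \<open>c = 0\<close> and \<open>w\<close> for \<open>c = 1\<close>.\<close>
  interpret bit_substitution "\<lambda>k. sign_bit (d k)" "\<lambda>i. sign_bit (v i)"
    "\<lambda>i. sign_bit (v i) + sign_bit (w i)" p
  proof
    show "sign_bit (d (2 * n + 1)) + sign_bit (d (2 * n + 2)) + sign_bit (d n) +
        sign_bit (d (n + 1)) = 1" for n
      by (rule apwenian_recurrence[OF \<open>apwenian d\<close>])
    show "sign_bit (d (p * m + i)) =
        sign_bit (v i) + (sign_bit (v i) + sign_bit (w i)) * sign_bit (d m)" if "i < p" for i m
      using fixp[OF that, of m] d[of m] by (auto simp: sign_bit_def)
  qed fact
  have "w i = - v i" if "i < p" for i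
    using digits_all_flip[OF that] assms(2,3)[OF that] by (auto simp: sign_bit_def)
  then have scale: "d (p * m + i) = v i * d m" if "i < p" for m i
    using fixp[OF that, of m] d[of m] that by auto
  \<comment> \<open>As \<open>v 0 = 1\<close>, every iterate of the substitution on 1 starts with
    1.\<close>
  have "d 0 = 1"
  proof -
    have "\<forall>\<^sub>F n in sequentially. (subst_ext \<sigma> ^^ n) [1] ! 0 = d 0"
      using assms(7) unfolding words_tendsto_def by (auto elim: eventually_mono)
    then obtain n where "(subst_ext \<sigma> ^^ n) [1] ! 0 = d 0"
      using eventually_happens'[OF sequentially_bot] by blast
    moreover have "(subst_ext \<sigma> ^^ n) [1] \<noteq> [] \<and> hd ((subst_ext \<sigma> ^^ n) [1]) = 1" for n
    proof (induction n)
      case (Suc n)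
      then obtain u where u: "(subst_ext \<sigma> ^^ n) [1] = 1 # u" by (metis list.collapse)
      have "\<sigma> 1 = 1 # map v [1..<p]"
        using assms(1,4,5) by (simp add: upt_conv_Cons)
      then have "(subst_ext \<sigma> ^^ Suc n) [1] = 1 # map v [1..<p] @ concat (map \<sigma> u)"
        using u by (simp add: subst_ext_def[of _ "1 # u"])
      then show ?case by (simp only: list.sel list.simps) simp
    qed simp
    ultimately show ?thesis by (metis hd_conv_nth)
  qed
  then have "fps_nth f 0 = 1" using \<open>f = Abs_fps d\<close> by simp
  moreover have "f = P * (f oo fps_X ^ p)"
    unfolding assms(8,9) using assms(1) scale by (intro fps_eq_mult_compose_power) auto
  ultimately show ?thesis by (intro has_prod_compose_power assms(1))
qed

end
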